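(* Let $k$ be a field and let $v_1,\ldots,v_q\in\mathbb{N}^n$ $(q\geq n)$ be such that the associated monomials $\mathbf{X}^{v_1},\ldots,\mathbf{X}^{v_q}$ have the same degree $d\geq 1$. If the ideal $(\mathbf{X}^{v_1},\ldots,\mathbf{X}^{v_q})\subset k[\mathbf{X}]=k[X_1,\ldots,X_n]$ is normal, then $\{(v_1,1),\ldots,(v_q,1)\}\subset\mathbb{Z}^{n+1}$ is a Hilbert base.
   Context: For $v=(a_1,\ldots,a_n)\in\mathbb{N}^n$ write $\mathbf{X}^v=X_1^{a_1}\cdots X_n^{a_n}$. An ideal $I$ of a ring $R$ is normal if all its powers are integrally closed in $R$. For a finite subset $H\subset\mathbb{R}^m$, $\mathbb{R}_+H$ denotes the set of linear combinations of elements of $H$ with nonnegative real coefficients and $\mathbb{N}H$ the set of linear combinations with nonnegative integer coefficients. A finite subset $H\subset\mathbb{R}^m$ is a Hilbert base if $\mathbb{Z}^m\cap\mathbb{R}_+H=\mathbb{N}H$. *)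

theory Defs
  imports "HOL-Analysis.Analysis" "HOL-Library.Poly_Mapping"
begin

text \<open>
  The polynomial ring $k[X_1,\ldots,X_n]$: finitely supported functions from exponent vectors
  to coefficients, with the convolution product; the variables are indexed by the finite type
  \<open>'n\<close>, so that $n$ is \<open>CARD('n)\<close>.
\<close>

type_synonym ('n, 'k) mpoly = "('n \<Rightarrow>\<^sub>0 nat) \<Rightarrow>\<^sub>0 'k"

definition mvar :: "'n \<Rightarrow> ('n, 'k::comm_ring_1) mpoly" where
  "mvar i = Poly_Mapping.single (Poly_Mapping.single i 1) 1"

definition monom_of :: "nat ^ 'n \<Rightarrow> ('n::finite, 'k::comm_ring_1) mpoly" where
  "monom_of v = (\<Prod>i\<in>UNIV. mvar i ^ (v $ i))"

text \<open>
  An ideal of a commutative ring is a submodule of the ring regarded as a module over itself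
  by multiplication, so the ideal generated by a set is its span in that module.
\<close>

definition ideal_gen :: "'a::comm_ring_1 set \<Rightarrow> 'a set" where
  "ideal_gen S = module.span (*) S"

primrec ideal_power :: "'a::comm_ring_1 set \<Rightarrow> nat \<Rightarrow> 'a set" where
  "ideal_power I 0 = UNIV"
| "ideal_power I (Suc r) = ideal_gen {x * y | x y. x \<in> I \<and> y \<in> ideal_power I r}"

definition integral_closure_ideal :: "'a::comm_ring_1 set \<Rightarrow> 'a set" where
  "integral_closure_ideal I =
     {z. \<exists>m\<ge>1. \<exists>a. (\<forall>j\<in>{1..m}. a j \<in> ideal_power I j) \<and>
           z ^ m + (\<Sum>j=1..m. a j * z ^ (m - j)) = 0}"

definition integrally_closed_ideal :: "'a::comm_ring_1 set \<Rightarrow> bool" where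
  "integrally_closed_ideal I \<longleftrightarrow> integral_closure_ideal I = I"

definition normal_ideal :: "'a::comm_ring_1 set \<Rightarrow> bool" where
  "normal_ideal I \<longleftrightarrow>
     module.subspace (*) I \<and> (\<forall>r\<ge>1. integrally_closed_ideal (ideal_power I r))"

definition nonneg_real_combs :: "(real ^ 'm::finite) set \<Rightarrow> (real ^ 'm) set" where
  "nonneg_real_combs H = {(\<Sum>h\<in>H. c h *\<^sub>R h) | c. \<forall>h\<in>H. 0 \<le> c h}"

definition nat_combs :: "(real ^ 'm::finite) set \<Rightarrow> (real ^ 'm) set" where
  "nat_combs H = {(\<Sum>h\<in>H. real (c h) *\<^sub>R h) | c :: real ^ 'm \<Rightarrow> nat. True}"

definition Hilbert_base :: "(real ^ 'm::finite) set \<Rightarrow> bool" where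
  "Hilbert_base H \<longleftrightarrow>
     finite H \<and> {x. \<forall>i. x $ i \<in> \<int>} \<inter> nonneg_real_combs H = nat_combs H"

text \<open>
  The vector $(v,1)$ in $\mathbb{R}^{n+1}$: the coordinates are indexed by \<open>'n option\<close>, where
  \<open>None\<close> is the index of the last one.
\<close>

definition append_one :: "nat ^ 'n::finite \<Rightarrow> real ^ ('n option)" where
  "append_one v = (\<chi> i. case i of None \<Rightarrow> 1 | Some j \<Rightarrow> real (v $ j))"

end

theory Submission imports Defs begin

text \<open>
  Let \<open>I\<close> be the ideal generated by the monomials with exponents in \<open>V\<close>, all of degree \<open>d\<close>,
  and let \<open>(w, b)\<close> be an integral point of the cone spanned by the vectors \<open>(v, 1)\<close>,
  \<open>v \<in> V\<close>. Some positive multiple \<open>(m w, m b)\<close> is a sum of \<open>m b\<close> of these vectors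
  (\<open>integral_cone_multiple_in_nat_combs\<close>). For the monomial \<open>z\<close> with exponent \<open>w\<close> this says
  that \<open>z ^ m\<close> is a product of \<open>m b\<close> generators, so it lies in the \<open>m\<close>-th power of
  \<open>I ^ b\<close>, and \<open>z\<close> is integral over \<open>I ^ b\<close>. By normality \<open>z\<close> itself is in
  \<open>I ^ b\<close>.

  Since powers of \<open>I\<close> are monomial ideals, \<open>z\<close> is divisible by a product of \<open>b\<close> generators
  (\<open>keys_monomial_ideal_power\<close>). That product has degree \<open>b d\<close>, and so has \<open>z\<close>, because
  \<open>m w\<close> is a sum of \<open>m b\<close> vectors of degree \<open>d\<close>. Hence the two are equal, and \<open>(w, b)\<close> is
  a sum of \<open>b\<close> of the vectors \<open>(v, 1)\<close>.
\<close>

section \<open>Integral points of a cone\<close>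

lemma finite_bounded_integer_vectors:
  "finite {y :: real ^ 'm::finite. \<forall>i. y $ i \<in> \<int> \<and> \<bar>y $ i\<bar> \<le> B}"
proof -
  let ?A = "real_of_int ` {- \<lceil>B\<rceil>..\<lceil>B\<rceil>}"
  have "{y :: real ^ 'm. \<forall>i. y $ i \<in> \<int> \<and> \<bar>y $ i\<bar> \<le> B}
          \<subseteq> vec_lambda ` (UNIV \<rightarrow>\<^sub>E ?A)"
  proof
    fix y :: "real ^ 'm"
    assume y: "y \<in> {y. \<forall>i. y $ i \<in> \<int> \<and> \<bar>y $ i\<bar> \<le> B}"
    have "y $ i \<in> ?A" for i
    proof -
      obtain k where k: "y $ i = of_int k" using y by (auto elim: Ints_cases)
      moreover have "\<bar>y $ i\<bar> \<le> B" using y by auto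
      ultimately have "k \<le> \<lceil>B\<rceil>" "- k \<le> \<lceil>B\<rceil>" by linarith+
      with k show ?thesis by auto
    qed
    then have "($) y \<in> UNIV \<rightarrow>\<^sub>E ?A" by (auto simp: PiE_def)
    then show "y \<in> vec_lambda ` (UNIV \<rightarrow>\<^sub>E ?A)"
      by (metis image_eqI vec_nth_inverse)
  qed
  moreover have "finite ((UNIV :: 'm set) \<rightarrow>\<^sub>E ?A)" by (intro finite_PiE) auto
  ultimately show ?thesis by (meson finite_imageI finite_subset)
qed

text \<open>
  The coefficients of a real combination need not be rational, but a multiple of an integral
  vector \<open>x\<close> can be given natural coefficients without solving any linear system. Rounding down
  the coefficients of \<open>m *\<^sub>R x\<close> leaves an integral remainder that is bounded independently
  of \<open>m\<close>, so two different multiples leave the same remainder, and subtracting them gives the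
  combination.
\<close>

lemma integral_cone_multiple_in_nat_combs:
  fixes H :: "(real ^ 'm::finite) set"
  assumes fin: "finite H" and int: "\<And>h i. h \<in> H \<Longrightarrow> h $ i \<in> \<int>"
    and x: "x \<in> nonneg_real_combs H" "\<And>i. x $ i \<in> \<int>"
  obtains m :: nat where "m \<ge> 1" "real m *\<^sub>R x \<in> nat_combs H"
proof -
  obtain c where c: "\<And>h. h \<in> H \<Longrightarrow> 0 \<le> c h" and xc: "x = (\<Sum>h\<in>H. c h *\<^sub>R h)"
    using x(1) by (auto simp: nonneg_real_combs_def)
  define r where "r m = real m *\<^sub>R x - (\<Sum>h\<in>H. of_int \<lfloor>real m * c h\<rfloor> *\<^sub>R h)" for m :: nat
  let ?B = "\<Sum>h\<in>H. norm h"
  have "r m $ i \<in> \<int> \<and> \<bar>r m $ i\<bar> \<le> ?B" for m i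
  proof
    show "r m $ i \<in> \<int>"
      using int x(2) by (auto simp: r_def intro!: Ints_diff Ints_mult Ints_sum)
    have "r m = (\<Sum>h\<in>H. frac (real m * c h) *\<^sub>R h)"
      by (simp add: r_def xc frac_def scaleR_sum_right scaleR_diff_left sum_subtractf)
    then have "norm (r m) \<le> (\<Sum>h\<in>H. norm (frac (real m * c h) *\<^sub>R h))"
      by (simp only: norm_sum)
    also have "\<dots> \<le> ?B"
      by (intro sum_mono) (auto simp: mult_left_le_one_le frac_ge_0 less_imp_le[OF frac_lt_1])
    finally show "\<bar>r m $ i\<bar> \<le> ?B"
      using component_le_norm_cart[of "r m" i] by linarith
  qed
  then have "range r \<subseteq> {y. \<forall>i. y $ i \<in> \<int> \<and> \<bar>y $ i\<bar> \<le> ?B}" by auto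
  then have "finite (range r)" using finite_bounded_integer_vectors finite_subset by blast
  then have "\<not> inj r" using finite_imageD infinite_UNIV_nat by blast
  then obtain m n where "m < n" and eq: "r m = r n"
    by (metis injI linorder_neqE_nat)
  let ?e = "\<lambda>h. nat (\<lfloor>real n * c h\<rfloor> - \<lfloor>real m * c h\<rfloor>)"
  have e: "real (?e h) = of_int \<lfloor>real n * c h\<rfloor> - of_int \<lfloor>real m * c h\<rfloor>" if "h \<in> H" for h
  proof -
    have "real m * c h \<le> real n * c h"
      using c[OF that] \<open>m < n\<close> by (simp add: mult_right_mono)
    then have "\<lfloor>real m * c h\<rfloor> \<le> \<lfloor>real n * c h\<rfloor>" by (rule floor_mono)
    then show ?thesis by simp
  qed
  have "real (n - m) *\<^sub>R x = real n *\<^sub>R x - real m *\<^sub>R x"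
    using \<open>m < n\<close> by (simp add: of_nat_diff scaleR_diff_left)
  also have "\<dots> = (\<Sum>h\<in>H. of_int \<lfloor>real n * c h\<rfloor> *\<^sub>R h) - (\<Sum>h\<in>H. of_int \<lfloor>real m * c h\<rfloor> *\<^sub>R h)"
    using eq by (simp add: r_def algebra_simps)
  also have "\<dots> = (\<Sum>h\<in>H. real (?e h) *\<^sub>R h)"
    by (simp add: e scaleR_diff_left sum_subtractf)
  finally have "real (n - m) *\<^sub>R x \<in> nat_combs H"
    unfolding nat_combs_def by (intro CollectI exI[of _ ?e]) simp
  moreover have "n - m \<ge> 1" using \<open>m < n\<close> by simp
  ultimately show thesis using that by blast
qed

text \<open>
  Writing natural combinations as sums of lists, with repetitions in place of coefficients,
  turns them on the side of monomials into plain products of generators.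
\<close>

lemma sum_list_in_nat_combs:
  assumes "finite H" "set xs \<subseteq> H"
  shows "sum_list xs \<in> nat_combs H"
  using assms(2)
proof (induction xs)
  case Nil
  show ?case by (auto simp: nat_combs_def intro!: exI[of _ "\<lambda>_. 0"])
next
  case (Cons h xs)
  then obtain c :: "real ^ 'a \<Rightarrow> nat" where c: "sum_list xs = (\<Sum>g\<in>H. real (c g) *\<^sub>R g)"
    by (auto simp: nat_combs_def)
  have "h \<in> H" using Cons.prems by simp
  then have "(\<Sum>g\<in>H. real ((c(h := Suc (c h))) g) *\<^sub>R g) = sum_list (h # xs)"
    using assms(1) by (simp add: sum.remove c algebra_simps)
  then show ?case unfolding nat_combs_def
    by (intro CollectI exI[of _ "c(h := Suc (c h))"]) simp
qed

lemma nat_combs_sum_listE: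
  assumes "finite H" "x \<in> nat_combs H"
  obtains xs where "set xs \<subseteq> H" "x = sum_list xs"
proof -
  obtain c :: "real ^ 'a \<Rightarrow> nat" where c: "x = (\<Sum>h\<in>H. real (c h) *\<^sub>R h)"
    using assms(2) by (auto simp: nat_combs_def)
  have rep: "sum_list (replicate k h) = real k *\<^sub>R h" for k and h :: "real ^ 'a"
    by (induction k) (simp_all add: algebra_simps)
  have "\<exists>xs. set xs \<subseteq> H \<and> (\<Sum>h\<in>H. real (c h) *\<^sub>R h) = sum_list xs"
    using assms(1)
  proof (induction H rule: finite_induct)
    case empty
    show ?case by simp
  next
    case (insert h F)
    then obtain xs where "set xs \<subseteq> F" "(\<Sum>h\<in>F. real (c h) *\<^sub>R h) = sum_list xs" by blast
    then show ?case using insert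
      by (intro exI[of _ "replicate (c h) h @ xs"])
        (auto simp: rep)
  qed
  with c that show thesis by blast
qed

lemma nat_combs_subset_nonneg_real_combs: "nat_combs H \<subseteq> nonneg_real_combs H"
  unfolding nat_combs_def nonneg_real_combs_def by fastforce

section \<open>Ideals and their powers\<close>

lemma module_mult: "module ((*) :: 'a::comm_ring_1 \<Rightarrow> 'a \<Rightarrow> 'a)"
  by unfold_locales (simp_all add: algebra_simps)

lemma subspace_ideal_power: "module.subspace (*) (ideal_power I r)"
  by (cases r) (simp_all add: ideal_gen_def module.subspace_span[OF module_mult]
      module.subspace_UNIV[OF module_mult])

lemma mult_in_ideal_power_Suc:
  assumes "x \<in> I" "y \<in> ideal_power I r"
  shows "x * y \<in> ideal_power I (Suc r)"
  using assms by (auto simp: ideal_gen_def intro!: module.span_base[OF module_mult])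

lemma prod_list_in_ideal_power:
  "set xs \<subseteq> I \<Longrightarrow> prod_list xs \<in> ideal_power I (length xs)"
proof (induction xs)
  case (Cons x xs)
  then show ?case using mult_in_ideal_power_Suc[of x I "prod_list xs" "length xs"] by simp
qed simp

text \<open>
  Cutting the list of factors into \<open>m\<close> blocks of length \<open>b\<close> exhibits the product as a product
  of \<open>m\<close> elements of the \<open>b\<close>-th power.
\<close>

lemma prod_list_in_ideal_power_power:
  "set xs \<subseteq> I \<Longrightarrow> length xs = m * b \<Longrightarrow> prod_list xs \<in> ideal_power (ideal_power I b) m"
proof (induction m arbitrary: xs)
  case 0
  show ?case by simp
next
  case (Suc m)
  have "prod_list (take b xs) \<in> ideal_power I b"
    using prod_list_in_ideal_power[of "take b xs" I] Suc.prems
    by (auto dest: in_set_takeD)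
  moreover have "prod_list (drop b xs) \<in> ideal_power (ideal_power I b) m"
    using Suc.prems by (intro Suc.IH) (auto dest: in_set_dropD)
  ultimately have "prod_list (take b xs) * prod_list (drop b xs)
      \<in> ideal_power (ideal_power I b) (Suc m)"
    by (rule mult_in_ideal_power_Suc)
  then show ?case by (metis append_take_drop_id prod_list.append)
qed

text \<open>
  The polynomial \<open>T ^ m - z ^ m\<close> is the equation of integral dependence.
\<close>

lemma integral_closure_idealI_power:
  assumes "m \<ge> 1" "z ^ m \<in> ideal_power I m"
  shows "z \<in> integral_closure_ideal I"
proof -
  let ?a = "\<lambda>j. if j = m then - (z ^ m) else 0"
  have "?a j \<in> ideal_power I j" for j
    using assms(2) subspace_ideal_power[of I j]
    by (auto intro: module.subspace_neg[OF module_mult] module.subspace_0[OF module_mult])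
  moreover have "(\<Sum>j=1..m. ?a j * z ^ (m - j)) = (\<Sum>j=1..m. if j = m then - (z ^ m) else 0)"
    by (intro sum.cong) auto
  then have "z ^ m + (\<Sum>j=1..m. ?a j * z ^ (m - j)) = 0"
    using assms(1) by simp
  ultimately show ?thesis using assms(1) unfolding integral_closure_ideal_def
    by (intro CollectI exI[of _ m] conjI exI[of _ ?a]) simp_all
qed

section \<open>Monomials\<close>

lemma monom_of_0: "monom_of 0 = 1"
  by (simp add: monom_of_def)

lemma monom_of_add: "monom_of (v + w) = monom_of v * monom_of w"
  by (simp add: monom_of_def power_add prod.distrib)

lemma monom_of_sum_list: "monom_of (sum_list vs) = prod_list (map monom_of vs)"
  by (induction vs) (simp_all add: monom_of_0 monom_of_add)

lemma monom_of_power: "monom_of v ^ m = monom_of (sum_list (replicate m v))"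
  by (simp add: monom_of_sum_list map_replicate prod_list_replicate)

lemma mvar_power: "mvar i ^ k = Poly_Mapping.single (Poly_Mapping.single i k) 1"
  by (induction k) (simp_all add: mvar_def mult_single single_add[symmetric])

lemma prod_single_1:
  "(\<Prod>i\<in>A. Poly_Mapping.single (f i) 1) = Poly_Mapping.single (\<Sum>i\<in>A. f i) (1 :: 'k::comm_ring_1)"
  by (induction A rule: infinite_finite_induct) (simp_all add: mult_single)

lemma keys_monom_of:
  "Poly_Mapping.keys (monom_of v :: ('n::finite, 'k::field) mpoly)
     = {p. Poly_Mapping.lookup p = ($) v}"
proof -
  let ?p = "\<Sum>i\<in>UNIV. Poly_Mapping.single i (v $ i)"
  have "Poly_Mapping.lookup ?p = ($) v"
    by (auto simp: lookup_sum lookup_single when_def)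
  then have "{p. Poly_Mapping.lookup p = ($) v} = {?p}"
    by (auto intro: poly_mapping_eqI)
  moreover have "(monom_of v :: ('n, 'k) mpoly) = Poly_Mapping.single ?p 1"
    by (simp add: monom_of_def mvar_power prod_single_1)
  ultimately show ?thesis by simp
qed

text \<open>
  Adding to exponents is multiplying by monomials, so the polynomials supported in a set that is
  closed under adding exponents form an ideal. This bounds the support of the elements of an
  ideal by the support of its generators.
\<close>

lemma subspace_keys_subset_upward_closed:
  fixes U :: "('n \<Rightarrow>\<^sub>0 nat) set"
  assumes "\<And>p u. p \<in> U \<Longrightarrow> u + p \<in> U"
  shows "module.subspace (*) {f :: ('n, 'k::comm_ring_1) mpoly. Poly_Mapping.keys f \<subseteq> U}"
proof (rule module.subspaceI[OF module_mult])
  fix f g :: "('n, 'k) mpoly"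
  assume "f \<in> {f. Poly_Mapping.keys f \<subseteq> U}" "g \<in> {f. Poly_Mapping.keys f \<subseteq> U}"
  then show "f + g \<in> {f. Poly_Mapping.keys f \<subseteq> U}" using keys_add[of f g] by blast
next
  fix c f :: "('n, 'k) mpoly"
  assume "f \<in> {f. Poly_Mapping.keys f \<subseteq> U}"
  then show "c * f \<in> {f. Poly_Mapping.keys f \<subseteq> U}" using keys_mult[of c f] assms by blast
qed simp

lemma keys_subset_of_mem_ideal_gen:
  fixes U :: "('n \<Rightarrow>\<^sub>0 nat) set" and S :: "('n, 'k::comm_ring_1) mpoly set"
  assumes "\<And>p u. p \<in> U \<Longrightarrow> u + p \<in> U" and "\<And>f. f \<in> S \<Longrightarrow> Poly_Mapping.keys f \<subseteq> U"
    and "f \<in> ideal_gen S"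
  shows "Poly_Mapping.keys f \<subseteq> U"
proof -
  have "module.span (*) S \<subseteq> {f. Poly_Mapping.keys f \<subseteq> U}"
    using assms(2) subspace_keys_subset_upward_closed[of U, OF assms(1)]
    by (intro module.span_minimal[OF module_mult]) auto
  then show ?thesis using assms(3) by (auto simp: ideal_gen_def)
qed

text \<open>
  Powers of monomial ideals are again monomial ideals: each monomial in the support of an element
  of the \<open>r\<close>-th power is divisible by a product of \<open>r\<close> generators.
\<close>

lemma keys_monomial_ideal_power:
  fixes V :: "(nat ^ 'n::finite) set"
  assumes "f \<in> ideal_power (ideal_gen (monom_of ` V :: ('n, 'k::field) mpoly set)) r"
    and "p \<in> Poly_Mapping.keys f"
  shows "\<exists>vs. set vs \<subseteq> V \<and> length vs = r \<and> (\<forall>i. sum_list vs $ i \<le> Poly_Mapping.lookup p i)"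
  using assms
proof (induction r arbitrary: f p)
  case 0
  show ?case by simp
next
  case (Suc r)
  let ?I = "ideal_gen (monom_of ` V :: ('n, 'k) mpoly set)"
  let ?U = "\<lambda>r. {p :: 'n \<Rightarrow>\<^sub>0 nat.
      \<exists>vs. set vs \<subseteq> V \<and> length vs = r \<and> (\<forall>i. sum_list vs $ i \<le> Poly_Mapping.lookup p i)}"
  have up: "u + p \<in> ?U s" if "p \<in> ?U s" for u p s
    using that by (auto simp: lookup_add intro: trans_le_add2)
  have prods: "Poly_Mapping.keys (x * y) \<subseteq> ?U (Suc r)"
    if x: "x \<in> ?I" and y: "y \<in> ideal_power ?I r" for x y
  proof
    fix p
    assume "p \<in> Poly_Mapping.keys (x * y)"
    then obtain a b where ab: "p = a + b" "a \<in> Poly_Mapping.keys x" "b \<in> Poly_Mapping.keys y"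
      using keys_mult[of x y] by blast
    have "Poly_Mapping.keys x \<subseteq> {a. \<exists>w\<in>V. \<forall>i. w $ i \<le> Poly_Mapping.lookup a i}"
      by (rule keys_subset_of_mem_ideal_gen[OF _ _ x])
        (auto simp: lookup_add keys_monom_of intro: trans_le_add2)
    then obtain w where w: "w \<in> V" "\<And>i. w $ i \<le> Poly_Mapping.lookup a i" using ab by blast
    obtain vs where vs: "set vs \<subseteq> V" "length vs = r"
      "\<And>i. sum_list vs $ i \<le> Poly_Mapping.lookup b i"
      using Suc.IH[OF y ab(3)] by blast
    show "p \<in> ?U (Suc r)"
      using w vs ab(1) by (auto simp: lookup_add intro!: exI[of _ "w # vs"] add_mono)
  qed
  have f: "f \<in> ideal_gen {x * y | x y. x \<in> ?I \<and> y \<in> ideal_power ?I r}"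
    using Suc.prems(1) by simp
  have "Poly_Mapping.keys f \<subseteq> ?U (Suc r)"
  proof (rule keys_subset_of_mem_ideal_gen[OF up _ f])
    fix g
    assume "g \<in> {x * y | x y. x \<in> ?I \<and> y \<in> ideal_power ?I r}"
    then obtain x y where "x \<in> ?I" "y \<in> ideal_power ?I r" and g: "g = x * y" by blast
    then show "Poly_Mapping.keys g \<subseteq> ?U (Suc r)" unfolding g by (intro prods)
  qed
  then show ?case using Suc.prems(2) by blast
qed

lemma exponent_eq_of_le_of_degree:
  fixes w :: "nat ^ 'n::finite"
  assumes "\<And>i. u $ i \<le> w $ i" "(\<Sum>i\<in>UNIV. w $ i) \<le> (\<Sum>i\<in>UNIV. u $ i)"
  shows "u = w"
proof -
  have "(\<Sum>i\<in>UNIV. u $ i) = (\<Sum>i\<in>UNIV. w $ i)"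
    using assms by (intro antisym[OF sum_mono]) auto
  then have "u $ i = w $ i" for i using assms(1) sum_mono_inv[of "($) u" UNIV "($) w" i] by simp
  then show ?thesis by (simp add: vec_eq_iff)
qed

lemma degree_sum_list:
  fixes vs :: "(nat ^ 'n::finite) list"
  assumes "\<And>v. v \<in> set vs \<Longrightarrow> (\<Sum>i\<in>UNIV. v $ i) = d"
  shows "(\<Sum>i\<in>UNIV. sum_list vs $ i) = length vs * d"
  using assms by (induction vs) (simp_all add: sum.distrib)

section \<open>Normality and Hilbert bases\<close>

lemma append_one_None: "append_one v $ None = 1"
  and append_one_Some: "append_one v $ Some i = real (v $ i)"
  by (simp_all add: append_one_def)

lemma sum_list_append_one_nth:
  shows "sum_list (map append_one vs) $ None = real (length vs)"
    and "sum_list (map append_one vs) $ Some i = real (sum_list vs $ i)"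
  by (induction vs) (simp_all add: append_one_None append_one_Some)

text \<open>
  Normality allows division by \<open>m\<close>: if \<open>m w\<close> is a sum of \<open>m b\<close> exponents of generators, then
  \<open>w\<close> is a sum of \<open>b\<close> of them. Integral closedness of the \<open>b\<close>-th power gives \<open>b\<close>
  exponents whose sum is below \<open>w\<close>, and the common degree makes the sum equal to \<open>w\<close>.
\<close>

lemma normal_equigenerated_multiple:
  fixes V :: "(nat ^ 'n::finite) set"
  assumes deg: "\<And>v. v \<in> V \<Longrightarrow> (\<Sum>i\<in>UNIV. v $ i) = d"
    and normal: "normal_ideal (ideal_gen (monom_of ` V :: ('n, 'k::field) mpoly set))"
    and m: "m \<ge> 1"
    and us: "set us \<subseteq> V" "length us = m * b" "sum_list (replicate m w) = sum_list us"
  obtains vs where "set vs \<subseteq> V" "length vs = b" "sum_list vs = w"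
proof (cases "b = 0")
  case True
  (* Normality concerns only positive powers, but m w is now an empty sum. *)
  have "w $ i = 0" for i
  proof -
    have "sum_list (replicate k w) $ i = k * w $ i" for k by (induction k) auto
    then show ?thesis using us True m by (metis length_0_conv mult_0_right mult_eq_0_iff
      not_one_le_zero sum_list.Nil zero_index)
  qed
  then have "w = 0" by (simp add: vec_eq_iff)
  with True that[of "[]"] show ?thesis by simp
next
  case False
  let ?G = "monom_of ` V :: ('n, 'k) mpoly set"
  let ?I = "ideal_gen ?G"
  let ?z = "monom_of w :: ('n, 'k) mpoly"
  have "?G \<subseteq> ?I" unfolding ideal_gen_def by (rule module.span_superset[OF module_mult])
  then have "prod_list (map monom_of us :: ('n, 'k) mpoly list) \<in> ideal_power (ideal_power ?I b) m"
    using us by (intro prod_list_in_ideal_power_power) auto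
  then have "?z ^ m \<in> ideal_power (ideal_power ?I b) m"
    by (simp add: monom_of_power us(3) monom_of_sum_list[symmetric])
  then have "?z \<in> integral_closure_ideal (ideal_power ?I b)"
    using m by (rule integral_closure_idealI_power[rotated])
  then have z: "?z \<in> ideal_power ?I b"
    using normal False by (auto simp: normal_ideal_def integrally_closed_ideal_def)
  have "Abs_poly_mapping (($) w) \<in> Poly_Mapping.keys ?z" by (simp add: keys_monom_of)
  then obtain vs where vs: "set vs \<subseteq> V" "length vs = b" "\<And>i. sum_list vs $ i \<le> w $ i"
    using keys_monomial_ideal_power[OF z] by fastforce
  have "m * (\<Sum>i\<in>UNIV. w $ i) = (\<Sum>i\<in>UNIV. sum_list (replicate m w) $ i)"
    using degree_sum_list[of "replicate m w" "\<Sum>i\<in>UNIV. w $ i"] by simp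
  also have "\<dots> = m * (b * d)"
    using degree_sum_list[of us d] deg us by (auto simp: mult.assoc)
  finally have "(\<Sum>i\<in>UNIV. w $ i) = b * d" using m by simp
  moreover have "(\<Sum>i\<in>UNIV. sum_list vs $ i) = b * d"
    using degree_sum_list[of vs d] deg vs by auto
  ultimately have "sum_list vs = w" using vs(3) by (intro exponent_eq_of_le_of_degree) auto
  with vs that show ?thesis by blast
qed

lemma Hilbert_base_of_normal_equigenerated:
  fixes V :: "(nat ^ 'n::finite) set"
  assumes fin: "finite V" and deg: "\<And>v. v \<in> V \<Longrightarrow> (\<Sum>i\<in>UNIV. v $ i) = d"
    and normal: "normal_ideal (ideal_gen (monom_of ` V :: ('n, 'k::field) mpoly set))"
  shows "Hilbert_base (append_one ` V)"
proof -
  let ?H = "append_one ` V"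
  have H_nat: "h $ i \<in> \<nat>" if "h \<in> ?H" for h i
    using that by (cases i) (auto simp: append_one_None append_one_Some)
  have "{x. \<forall>i. x $ i \<in> \<int>} \<inter> nonneg_real_combs ?H \<subseteq> nat_combs ?H"
  proof
    fix x :: "real ^ 'n option"
    assume "x \<in> {x. \<forall>i. x $ i \<in> \<int>} \<inter> nonneg_real_combs ?H"
    then have x: "x \<in> nonneg_real_combs ?H" "\<And>i. x $ i \<in> \<int>" by auto
    obtain m where m: "m \<ge> 1" "real m *\<^sub>R x \<in> nat_combs ?H"
      using integral_cone_multiple_in_nat_combs[OF _ _ x] fin H_nat Nats_subset_Ints by blast
    then obtain hs where hs: "set hs \<subseteq> ?H" "real m *\<^sub>R x = sum_list hs"
      using nat_combs_sum_listE fin by (metis finite_imageI)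
    obtain us where us: "set us \<subseteq> V" "hs = map append_one us"
      using hs(1) lists_image[of append_one V] by (auto simp: lists_eq_set image_iff set_eq_iff)
    have "x $ i \<ge> 0" for i
    proof -
      have "0 \<le> real m * x $ i"
        using arg_cong[OF hs(2), of "\<lambda>y. y $ i"]
        by (cases i) (simp_all add: us(2) sum_list_append_one_nth)
      then show ?thesis using m(1) by (simp add: zero_le_mult_iff)
    qed
    then have nat: "real (nat \<lfloor>x $ i\<rfloor>) = x $ i" for i
      using x(2)[of i] by (auto elim!: Ints_cases)
    define b where "b = nat \<lfloor>x $ None\<rfloor>"
    define w where "w = (\<chi> i. nat \<lfloor>x $ Some i\<rfloor>)"
    have b: "x $ None = real b" and w: "x $ Some i = real (w $ i)" for i
      by (simp_all add: b_def w_def nat)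
    have "real (m * b) = real (length us)"
      using arg_cong[OF hs(2), of "\<lambda>y. y $ None"] by (simp add: us(2) sum_list_append_one_nth b)
    then have len: "length us = m * b" using of_nat_eq_iff by metis
    have "sum_list (replicate m w) $ i = sum_list us $ i" for i
    proof -
      have "sum_list (replicate k w) $ i = k * w $ i" for k by (induction k) auto
      moreover have "real (m * w $ i) = real (sum_list us $ i)"
        using arg_cong[OF hs(2), of "\<lambda>y. y $ Some i"]
        by (simp add: us(2) sum_list_append_one_nth w)
      ultimately show ?thesis using of_nat_eq_iff by metis
    qed
    then have "sum_list (replicate m w) = sum_list us" by (simp add: vec_eq_iff)
    then obtain vs where vs: "set vs \<subseteq> V" "length vs = b" "sum_list vs = w"
      using normal_equigenerated_multiple[OF deg normal m(1) us(1) len] by blast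
    have "x $ i = sum_list (map append_one vs) $ i" for i
      by (cases i) (simp_all add: sum_list_append_one_nth vs b w)
    then have "x = sum_list (map append_one vs)" by (simp add: vec_eq_iff)
    then show "x \<in> nat_combs ?H"
      using sum_list_in_nat_combs[of ?H "map append_one vs"] fin vs(1) by auto
  qed
  moreover have "nat_combs ?H \<subseteq> {x. \<forall>i. x $ i \<in> \<int>}"
    using H_nat Nats_subset_Ints by (fastforce simp: nat_combs_def intro!: Ints_sum Ints_mult)
  ultimately show ?thesis
    using fin nat_combs_subset_nonneg_real_combs[of ?H] by (auto simp: Hilbert_base_def)
qed

theorem theorem3p4:
  fixes v :: "nat \<Rightarrow> nat ^ 'n::finite" and q d :: nat
  assumes "q \<ge> CARD('n)"
    and "d \<ge> 1"
    and "\<forall>j\<in>{1..q}. (\<Sum>i\<in>UNIV. v j $ i) = d"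
    and "normal_ideal (ideal_gen ((\<lambda>j. monom_of (v j) :: ('n, 'k::field) mpoly) ` {1..q}))"
  shows "Hilbert_base ((\<lambda>j. append_one (v j)) ` {1..q})"
  using Hilbert_base_of_normal_equigenerated[of "v ` {1..q}" d] assms(3,4)
  by (auto simp: image_image)

end
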